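(* Let $\mathbb{P}^*$ be the set of all finite words $w=w(1)w(2)\cdots w(n)$ ($n\ge 0$) with letters in the positive integers $\mathbb{P}$ (i.e. integer compositions), partially ordered by $u\le w$ iff $w$ has a subword $w(i_1)w(i_2)\cdots w(i_l)$, $i_1<\dots<i_l$, $l=|u|$, with $u(j)\le w(i_j)$ for $1\le j\le l$. Then for all $u,w\in\mathbb{P}^*$ with $u\le w$, $$\mu(u,w)=\sum_{\eta_u}(-1)^{d(\eta_u)},$$ where $\mu$ is the Möbius function of $\mathbb{P}^*$ and the sum is over all normal embeddings $\eta_u$ of $u$ into $w$.
   Context: $|w|$ denotes the length of a word. For a word $\eta$ over the nonnegative integers, $\operatorname{Supp}\eta=\{i:\eta(i)\neq 0\}$. An expansion of $u$ is a word $\eta_u$ over the nonnegative integers whose restriction to its support (deleting all zeros) equals $u$. An embedding of $u$ into $w$ is an expansion $\eta_u$ of $u$ of length $|w|$ with $\eta_u(i)\le w(i)$ for $1\le i\le |w|$. A run of $k$'s in $w$ is a maximal interval of indices $[r,t]$ with $w(r)=w(r+1)=\dots=w(t)=k$. An embedding $\eta_u$ of $u$ into $w$ is normal if (1) for each $1\le i\le |w|$, $\eta_u(i)\in\{w(i),w(i)-1,0\}$; and (2) for every $k\ge1$ and every run $[r,t]$ of $k$'s in $w$: if $k=1$ then $(r,t]=\{r+1,\dots,t\}\subseteq\operatorname{Supp}\eta_u$, and if $k\ge2$ then $r\in\operatorname{Supp}\eta_u$. The defect of a normal embedding is $d(\eta_u)=\#\{i:\eta_u(i)=w(i)-1\}$.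 *)

theory Defs
  imports Main "HOL-Library.Sublist"
begin

class locally_finite_order = order +
  assumes finite_interval: "finite {x..y}"

text \<open>The defining recursion \<open>\<mu>(x,x) = 1\<close>, \<open>\<Sum>\<^sub>x\<^sub>\<le>\<^sub>z\<^sub>\<le>\<^sub>y \<mu>(x,z) = 0\<close> for \<open>x < y\<close>,
  and \<open>\<mu>(x,y) = 0\<close> if \<open>x\<close> is not below \<open>y\<close>.\<close>

function mobius :: "'a::locally_finite_order \<Rightarrow> 'a \<Rightarrow> int" where
  "mobius x y = (if x = y then 1
                 else if x < y then - (\<Sum>z\<in>{x..<y}. mobius x z)
                 else 0)"
  by pat_completeness auto
termination
proof (relation "measure (\<lambda>(x, y). card {x..y})")
  fix x y z :: 'a
  assume "x < y" and z: "z \<in> {x..<y}"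
  then have "{x..z} \<subset> {x..y}"
    by (auto simp: less_le_not_le intro: order_trans)
  then show "((x, z), x, y) \<in> measure (\<lambda>(x, y). card {x..y})"
    by (simp add: psubset_card_mono finite_interval)
qed simp

declare mobius.simps [simp del]

typedef composition = "{w :: nat list. \<forall>a\<in>set w. 0 < a}"
  morphisms letters Composition
  by (rule exI[of _ "[]"]) simp

lemma letters_pos: "a \<in> set (letters w) \<Longrightarrow> 0 < a"
  using letters[of w] by simp

definition subword_le :: "nat list \<Rightarrow> nat list \<Rightarrow> bool" where
  "subword_le u w \<longleftrightarrow> (\<exists>v. subseq v w \<and> list_all2 (\<le>) u v)"

lemma subword_le_iff_list_emb: "subword_le u w \<longleftrightarrow> list_emb (\<le>) u w"
proof
  assume "subword_le u w"
  then obtain v where v: "subseq v w" "list_all2 (\<le>) u v"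
    unfolding subword_le_def by blast
  then show "list_emb (\<le>) u w"
  proof (induction arbitrary: u rule: list_emb.induct)
    case (list_emb_Cons2 x y xs ys)
    from list_emb_Cons2.prems obtain z zs where
      "u = z # zs" "z \<le> y" "list_all2 (\<le>) zs xs"
      using list_emb_Cons2.hyps by (auto simp: list_all2_Cons2)
    then show ?case using list_emb_Cons2.IH by (simp add: list_emb.list_emb_Cons2)
  qed auto
next
  assume "list_emb (\<le>) u w"
  then show "subword_le u w"
    unfolding subword_le_def
  proof (induction rule: list_emb.induct)
    case (list_emb_Nil ys)
    then show ?case by (intro exI[of _ "[]"]) simp
  next
    case (list_emb_Cons xs ys y)
    then show ?case by (meson list_emb.list_emb_Cons)
  next
    case (list_emb_Cons2 x y xs ys)
    then obtain v where "subseq v ys" "list_all2 (\<le>) xs v" by blast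
    with list_emb_Cons2.hyps show ?case by (intro exI[of _ "y # v"]) simp
  qed
qed

lemma subword_le_length: "subword_le u w \<Longrightarrow> length u \<le> length w"
  by (simp add: subword_le_iff_list_emb list_emb_length)

lemma subword_le_refl: "subword_le u u"
  unfolding subword_le_def by (intro exI[of _ u]) (simp add: list_all2_refl)

lemma subword_le_trans: "subword_le u v \<Longrightarrow> subword_le v w \<Longrightarrow> subword_le u w"
  unfolding subword_le_iff_list_emb by (rule list_emb_trans) auto

lemma subword_le_antisym:
  assumes "subword_le u w" "subword_le w u"
  shows "u = w"
proof -
  have len: "length u = length w"
    using assms by (meson subword_le_length le_antisym)
  have "list_all2 (\<le>) x y" if "subword_le x y" "length x = length y" for x y
    using that unfolding subword_le_def
    by (metis list_all2_lengthD subseq_same_length)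
  then have "list_all2 (\<le>) u w" "list_all2 (\<le>) w u"
    using assms len by auto
  then show ?thesis
    by (auto simp: list_all2_conv_all_nth intro!: nth_equalityI le_antisym)
qed

instantiation composition :: order
begin

definition less_eq_composition :: "composition \<Rightarrow> composition \<Rightarrow> bool" where
  "u \<le> w \<longleftrightarrow> subword_le (letters u) (letters w)"

definition less_composition :: "composition \<Rightarrow> composition \<Rightarrow> bool" where
  "u < w \<longleftrightarrow> u \<le> w \<and> \<not> w \<le> (u :: composition)"

instance
proof
  fix x y z :: composition
  show "x < y \<longleftrightarrow> x \<le> y \<and> \<not> y \<le> x" by (rule less_composition_def)
  show "x \<le> x" by (simp add: less_eq_composition_def subword_le_refl)
  show "x \<le> z" if "x \<le> y" "y \<le> z"
    using that subword_le_trans unfolding less_eq_composition_def by blast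
  show "x = y" if "x \<le> y" "y \<le> x"
    using that subword_le_antisym letters_inject unfolding less_eq_composition_def by blast
qed

end

instance composition :: locally_finite_order
proof
  fix x y :: composition
  define L where "L = {xs. set xs \<subseteq> {..Max (set (letters y))} \<and> length xs \<le> length (letters y)}"
  have "letters v \<in> L" if "v \<le> y" for v
  proof -
    have emb: "list_emb (\<le>) (letters v) (letters y)"
      using that by (simp add: less_eq_composition_def subword_le_iff_list_emb)
    have "a \<le> Max (set (letters y))" if a: "a \<in> set (letters v)" for a
    proof -
      obtain b where b: "b \<in> set (letters y)" "a \<le> b"
        using list_emb_set[OF emb a] by blast
      then have "b \<le> Max (set (letters y))" by (simp add: Max_ge)
      with b(2) show ?thesis by (rule le_trans)
    qed
    moreover have "length (letters v) \<le> length (letters y)"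
      using that subword_le_length unfolding less_eq_composition_def by blast
    ultimately show ?thesis by (auto simp: L_def)
  qed
  then have "letters ` {x..y} \<subseteq> L" by auto
  moreover have "finite L"
    unfolding L_def by (rule finite_lists_length_le) simp
  ultimately have "finite (letters ` {x..y})"
    by (rule finite_subset)
  then show "finite {x..y}"
    by (rule finite_imageD) (auto simp: inj_on_def letters_inject)
qed

text \<open>Positions in words are counted from 0.\<close>

definition Supp :: "nat list \<Rightarrow> nat set" where
  "Supp \<eta> = {i. i < length \<eta> \<and> \<eta> ! i \<noteq> 0}"

definition expansion :: "nat list \<Rightarrow> nat list \<Rightarrow> bool" where
  "expansion \<eta> u \<longleftrightarrow> nths \<eta> (Supp \<eta>) = u"

definition embedding :: "nat list \<Rightarrow> nat list \<Rightarrow> nat list \<Rightarrow> bool" where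
  "embedding \<eta> u w \<longleftrightarrow> expansion \<eta> u \<and> length \<eta> = length w \<and> (\<forall>i<length w. \<eta> ! i \<le> w ! i)"

definition constant_interval :: "nat list \<Rightarrow> nat \<Rightarrow> nat \<Rightarrow> nat \<Rightarrow> bool" where
  "constant_interval w k r t \<longleftrightarrow> r \<le> t \<and> t < length w \<and> (\<forall>i\<in>{r..t}. w ! i = k)"

definition run :: "nat list \<Rightarrow> nat \<Rightarrow> nat \<Rightarrow> nat \<Rightarrow> bool" where
  "run w k r t \<longleftrightarrow> constant_interval w k r t \<and>
     (\<forall>r' t'. constant_interval w k r' t' \<and> {r..t} \<subseteq> {r'..t'} \<longrightarrow> {r'..t'} = {r..t})"

definition normal_embedding :: "nat list \<Rightarrow> nat list \<Rightarrow> nat list \<Rightarrow> bool" where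
  "normal_embedding \<eta> u w \<longleftrightarrow> embedding \<eta> u w \<and>
     (\<forall>i<length w. \<eta> ! i \<in> {w ! i, w ! i - 1, 0}) \<and>
     (\<forall>k r t. k \<ge> 1 \<and> run w k r t \<longrightarrow>
        (k = 1 \<longrightarrow> {r<..t} \<subseteq> Supp \<eta>) \<and> (k \<ge> 2 \<longrightarrow> r \<in> Supp \<eta>))"

text \<open>For \<open>w\<close> with positive letters the subtraction on \<open>nat\<close> here and above does not truncate;
  a letter 1 of \<open>w\<close> above a 0 of \<open>\<eta>\<close> counts towards the defect.\<close>

definition defect :: "nat list \<Rightarrow> nat list \<Rightarrow> nat" where
  "defect w \<eta> = card {i. i < length w \<and> \<eta> ! i = w ! i - 1}"

lemma finite_embeddings: "finite {\<eta>. embedding \<eta> u w}"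
proof (rule finite_subset)
  show "{\<eta>. embedding \<eta> u w} \<subseteq> {xs. set xs \<subseteq> {..Max (set w)} \<and> length xs = length w}"
  proof (clarsimp simp: embedding_def in_set_conv_nth)
    fix \<eta> i
    assume "\<forall>i<length w. \<eta> ! i \<le> w ! i" "i < length w"
    then have "\<eta> ! i \<le> w ! i" "w ! i \<le> Max (set w)" by simp_all
    then show "\<eta> ! i \<le> Max (set w)" by (rule le_trans)
  qed
  show "finite {xs. set xs \<subseteq> {..Max (set w)} \<and> length xs = length w}"
    by (rule finite_lists_length_eq) simp
qed

lemma finite_normal_embeddings: "finite {\<eta>. normal_embedding \<eta> u w}"
  by (rule finite_subset[OF _ finite_embeddings[of u w]]) (auto simp: normal_embedding_def)

end

theory Submission imports Defs begin

text \<open>By uniqueness of inverses in the incidence algebra it suffices to show that the sums \<open>M(v,w)\<close>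
  over normal embeddings satisfy the dual recursion: \<open>\<Sum>\<^sub>u\<^sub>\<le>\<^sub>v\<^sub>\<le>\<^sub>w M(v,w)\<close> is 1 if \<open>u = w\<close> and 0 otherwise.
  This is the signed count of all normal \<open>\<eta>\<close> in \<open>w\<close> whose support restriction lies above \<open>u\<close>.
  Normality at a position depends only on the letter there and the preceding one,
  and \<open>u \<le> v\<close> can be decided greedily from the left, so the count is computed by recursion
  on \<open>w\<close>, with the preceding letter \<open>p\<close> as a parameter. The signed count turns out to be 1 if
  \<open>w\<close> is \<open>u\<close> preceded by some number of letters \<open>p\<close>, and 0 otherwise; \<open>p = 0\<close> gives the claim.\<close>

section \<open>Inversion in the incidence algebra\<close>

lemma sum_mobius:
  fixes x y :: "'a::locally_finite_order"
  assumes "x \<le> y"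
  shows "(\<Sum>z\<in>{x..y}. mobius x z) = of_bool (x = y)"
proof (cases "x = y")
  case True
  then show ?thesis by (simp add: mobius.simps)
next
  case False
  with assms have "x < y" by simp
  then have "{x..y} = insert y {x..<y}" by auto
  moreover have "finite {x..<y}"
    by (rule finite_subset[OF _ finite_interval[of x y]]) auto
  ultimately show ?thesis
    using \<open>x < y\<close> by (simp add: mobius.simps[of x y])
qed

text \<open>Evaluate the double sum of \<open>mobius x z * g v\<close> over
  \<open>x \<le> z \<le> v \<le> y\<close> in two ways. Summing over \<open>v\<close> first leaves
  only \<open>z = y\<close> by hypothesis; summing over \<open>z\<close> first leaves only
  \<open>v = x\<close> by \<open>sum_mobius\<close>.\<close>

lemma mobius_eqI:
  fixes x y :: "'a::locally_finite_order" and g :: "'a \<Rightarrow> int"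
  assumes "x \<le> y"
    and g: "\<And>z. x \<le> z \<Longrightarrow> z \<le> y \<Longrightarrow> (\<Sum>v\<in>{z..y}. g v) = of_bool (z = y)"
  shows "mobius x y = g x"
proof -
  have fin: "finite {a..b}" for a b :: 'a by (rule finite_interval)
  have "mobius x y = (\<Sum>z\<in>{x..y}. mobius x z * of_bool (z = y))"
    using assms(1) fin[of x y] by (simp add: of_bool_def if_distrib sum.delta cong: if_cong)
  also have "\<dots> = (\<Sum>z\<in>{x..y}. \<Sum>v\<in>{v. v \<in> {x..y} \<and> z \<le> v}. mobius x z * g v)"
  proof (rule sum.cong[OF refl])
    fix z assume z: "z \<in> {x..y}"
    then have "{v. v \<in> {x..y} \<and> z \<le> v} = {z..y}" by auto
    with z show "mobius x z * of_bool (z = y)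
        = (\<Sum>v\<in>{v. v \<in> {x..y} \<and> z \<le> v}. mobius x z * g v)"
      by (simp add: g flip: sum_distrib_left)
  qed
  also have "\<dots> = (\<Sum>v\<in>{x..y}. \<Sum>z\<in>{z. z \<in> {x..y} \<and> z \<le> v}. mobius x z * g v)"
    by (rule sum.swap_restrict[OF fin fin])
  also have "\<dots> = (\<Sum>v\<in>{x..y}. of_bool (x = v) * g v)"
  proof (rule sum.cong[OF refl])
    fix v assume v: "v \<in> {x..y}"
    then have "{z. z \<in> {x..y} \<and> z \<le> v} = {x..v}" by auto
    with v show "(\<Sum>z\<in>{z. z \<in> {x..y} \<and> z \<le> v}. mobius x z * g v) = of_bool (x = v) * g v"
      by (simp add: sum_mobius flip: sum_distrib_right)
  qed
  also have "\<dots> = g x"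
  proof -
    have "of_bool (x = v) * g v = (if x = v then g v else 0)" for v by simp
    then show ?thesis using assms(1) fin[of x y] by simp
  qed
  finally show ?thesis .
qed

section \<open>Greedy matching and normal words\<close>

text \<open>Matching \<open>b\<close> as early as possible loses nothing: if \<open>b # u\<close>
  embeds into \<open>z\<close>, then so does \<open>u\<close>, so an embedding that skips
  \<open>x\<close> can be replaced by one that uses it.\<close>

lemma list_emb_Cons_greedy:
  "list_emb (\<le>) (b # u) (x # z) \<longleftrightarrow> (if b \<le> (x :: 'a :: preorder) then list_emb (\<le>) u z else list_emb (\<le>) (b # u) z)"
proof -
  have "list_emb (\<le>) u z" if "list_emb (\<le>) (b # u) z" for z
    using that by (metis list_emb_ConsD list_emb_Cons list_emb_append2)
  then show ?thesis by (auto simp: list_emb_Cons_iff1 list_emb_Cons_iff2)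
qed

lemma list_emb_filter_left:
  "list_all2 P xs ys \<Longrightarrow> list_emb P (filter Q xs) ys"
  by (induction rule: list_all2_induct) auto

text \<open>The run conditions made local: with \<open>p\<close> the letter before \<open>a\<close>,
  a 1 is not the first of its run iff \<open>p = 1\<close>, and a letter \<open>a \<ge> 2\<close> is
  the first of its run iff \<open>p \<noteq> a\<close>.\<close>

definition allowed :: "nat \<Rightarrow> nat \<Rightarrow> nat set" where
  "allowed p a = {x. x \<in> {a, a - 1, 0} \<and> (a = 1 \<and> p = 1 \<longrightarrow> x \<noteq> 0) \<and> (2 \<le> a \<and> p \<noteq> a \<longrightarrow> x \<noteq> 0)}"

fun normal_words :: "nat \<Rightarrow> nat list \<Rightarrow> nat list set" where
  "normal_words p [] = {[]}"
| "normal_words p (a # w) = (\<Union>x\<in>allowed p a. (#) x ` normal_words a w)"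

lemma finite_allowed: "finite (allowed p a)"
  by (rule finite_subset[of _ "{a, a - 1, 0}"]) (auto simp: allowed_def)

lemma finite_normal_words: "finite (normal_words p w)"
  by (induction p w rule: normal_words.induct) (auto simp: finite_allowed)

lemma normal_words_iff:
  "\<eta> \<in> normal_words p w \<longleftrightarrow>
    length \<eta> = length w \<and> (\<forall>i<length w. \<eta> ! i \<in> allowed ((p # w) ! i) (w ! i))"
proof (induction p w arbitrary: \<eta> rule: normal_words.induct)
  case (2 p a w)
  show ?case
    by (cases \<eta>) (auto simp: 2 All_less_Suc2 image_iff)
qed auto

lemma defect_Cons:
  "defect (a # w) (x # \<eta>) = (if x = a - 1 then 1 else 0) + defect w \<eta>"
proof -
  have "{i. i < length (a # w) \<and> (x # \<eta>) ! i = (a # w) ! i - 1} =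
      (if x = a - 1 then {0} else {}) \<union> Suc ` {i. i < length w \<and> \<eta> ! i = w ! i - 1}"
    by (auto simp: less_Suc_eq_0_disj image_iff split: if_splits)
  then show ?thesis
    unfolding defect_def by (auto simp: card_insert_if card_image)
qed

lemma sum_normal_words_Cons:
  "(\<Sum>\<eta>\<in>normal_words p (a # w). f \<eta>) = (\<Sum>x\<in>allowed p a. \<Sum>\<eta>\<in>normal_words a w. f (x # \<eta>))"
proof -
  have "(\<Sum>\<eta>\<in>normal_words p (a # w). f \<eta>) = (\<Sum>x\<in>allowed p a. sum f ((#) x ` normal_words a w))"
    unfolding normal_words.simps
    by (rule sum.UNION_disjoint) (auto simp: finite_allowed finite_normal_words)
  also have "\<dots> = (\<Sum>x\<in>allowed p a. \<Sum>\<eta>\<in>normal_words a w. f (x # \<eta>))"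
    by (simp add: sum.reindex)
  finally show ?thesis .
qed

section \<open>Recursion and closed form of the signed count\<close>

definition signed_count :: "nat \<Rightarrow> nat list \<Rightarrow> nat list \<Rightarrow> int" where
  "signed_count p u w = (\<Sum>\<eta>\<in>normal_words p w.
     (-1) ^ defect w \<eta> * of_bool (list_emb (\<le>) u (filter (\<lambda>x. x \<noteq> 0) \<eta>)))"

text \<open>The state of the greedy matching after reading \<open>x\<close>. A zero matches nothing,
  since zeros are deleted before the comparison.\<close>

definition consume :: "nat \<Rightarrow> nat list \<Rightarrow> nat list" where
  "consume x u = (if x \<noteq> 0 \<and> u \<noteq> [] \<and> hd u \<le> x then tl u else u)"

lemma list_emb_consume:
  "list_emb (\<le>) u (filter (\<lambda>x. x \<noteq> 0) (x # \<eta>)) \<longleftrightarrow>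
    list_emb (\<le>) (consume x u) (filter (\<lambda>x. x \<noteq> 0) \<eta>)"
  by (cases u) (auto simp: consume_def list_emb_Cons_greedy)

lemma signed_count_Cons:
  "signed_count p u (a # w) =
    (\<Sum>x\<in>allowed p a. (if x = a - 1 then - 1 else 1) * signed_count a (consume x u) w)"
  unfolding signed_count_def sum_normal_words_Cons sum_distrib_left list_emb_consume
  by (intro sum.cong refl) (simp add: defect_Cons)

lemma allowed_eq:
  assumes "0 < a"
  shows "allowed p a = (if a = 1 then (if p = 1 then {1} else {0, 1})
    else (if p = a then {0, a - 1, a} else {a - 1, a}))"
  using assms by (auto simp: allowed_def)

text \<open>For \<open>a \<ge> 2\<close> the choices \<open>a\<close> and \<open>a - 1\<close> have
  opposite signs and leave the same rest of \<open>u\<close>, hence cancel, unless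
  \<open>hd u = a\<close>; the choice 0 exists only for \<open>p = a\<close> and leaves
  \<open>u\<close> intact. For \<open>a = 1\<close> the choice 0 is also \<open>a - 1\<close>, hence
  negative, and is excluded when \<open>p = 1\<close>; the same formula results.\<close>

lemma signed_count_Cons':
  assumes "0 < a" "0 \<notin> set u"
  shows "signed_count p u (a # w) = of_bool (p = a) * signed_count a u w +
    (if u \<noteq> [] \<and> hd u = a then signed_count a (tl u) w - signed_count a u w else 0)"
  using assms
  by (cases u; cases "a = 1") (auto simp: signed_count_Cons allowed_eq consume_def)

lemma signed_count_eq:
  assumes "0 \<notin> set w" "0 \<notin> set u"
  shows "signed_count p u w = of_bool (\<exists>j. w = replicate j p @ u)"
  using assms
proof (induction w arbitrary: p u)
  case Nil
  then show ?case by (cases u) (auto simp: signed_count_def defect_def)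
next
  case (Cons a w)
  have IH: "signed_count a v w = of_bool (\<exists>j. w = replicate j a @ v)" if "0 \<notin> set v" for v
    using that Cons by simp
  \<comment> \<open>Separate \<open>j = 0\<close> from \<open>j > 0\<close>; a positive
    \<open>j\<close> forces \<open>p = a\<close>.\<close>
  have step: "(\<exists>j. a # w = replicate j p @ v) \<longleftrightarrow>
      a # w = v \<or> p = a \<and> (\<exists>j. w = replicate j a @ v)" (is "?l = ?r") for v
  proof
    assume ?l
    then obtain j where "a # w = replicate j p @ v" ..
    then show ?r by (cases j) auto
  next
    assume ?r
    then show ?l by (metis append_Cons append_Nil replicate_0 replicate_Suc)
  qed
  have unroll: "(\<exists>j. w = replicate j a @ v) \<longleftrightarrow>
      w = v \<or> (\<exists>j. w = replicate j a @ a # v)" (is "?l = ?r") for v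
  proof
    assume ?l
    then obtain j where "w = replicate j a @ v" ..
    then show ?r by (cases j) (auto simp: replicate_app_Cons_same)
  next
    assume ?r
    then show ?l by (metis append_Cons append_Nil replicate_0 replicate_Suc replicate_app_Cons_same)
  qed
  \<comment> \<open>This makes the two alternatives of \<open>unroll\<close> exclusive, so that they
    can be subtracted.\<close>
  have len: "\<not> (\<exists>j. w = replicate j a @ a # w)"
    by (metis append_Cons length_Cons length_append not_add_less2 lessI)
  have "signed_count p u (a # w) = of_bool (p = a) * signed_count a u w +
    (if u \<noteq> [] \<and> hd u = a then signed_count a (tl u) w - signed_count a u w else 0)"
    using Cons.prems by (intro signed_count_Cons') auto
  also have "\<dots> = of_bool (\<exists>j. a # w = replicate j p @ u)"
  proof (cases "u \<noteq> [] \<and> hd u = a")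
    case True
    then obtain v where u: "u = a # v" by (cases u) auto
    with Cons.prems have v: "0 \<notin> set v" by simp
    \<comment> \<open>The counts for \<open>v\<close> and \<open>a # v\<close> differ by exactly the
      indicator of \<open>w = v\<close>, that is, of \<open>a # w = u\<close>; this is the first
      alternative in \<open>step\<close>.\<close>
    show ?thesis
      unfolding step IH[OF Cons.prems(2)] using IH[OF v] unroll[of v] len
      by (auto simp: u)
  next
    case False
    then have "a # w \<noteq> u" by auto
    with False show ?thesis
      unfolding step IH[OF Cons.prems(2)] by auto
  qed
  finally show ?case .
qed

section \<open>Runs and the local form of normality\<close>

text \<open>A constant interval that is not a run has a proper constant extension, which lowers
  \<open>length w - (t - r)\<close>.\<close>

lemma run_exists:
  assumes "constant_interval w k r t"
  shows "\<exists>r' t'. run w k r' t' \<and> r' \<le> r \<and> t \<le> t'"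
  using assms
proof (induction "length w - (t - r)" arbitrary: r t rule: less_induct)
  case less
  show ?case
  proof (cases "run w k r t")
    case False
    with less.prems obtain r' t' where *: "constant_interval w k r' t'" "{r..t} \<subset> {r'..t'}"
      unfolding run_def by blast
    with less.prems have le: "r \<le> t" "r' \<le> r" "t \<le> t'" "t' < length w"
      by (auto simp: constant_interval_def)
    with *(2) have "r' < r \<or> t < t'" by (auto simp: psubset_eq)
    with le have "length w - (t' - r') < length w - (t - r)" by linarith
    from less.hyps[OF this *(1)] le show ?thesis by (meson le_trans)
  qed auto
qed

lemma run_nthD:
  "run w k r t \<Longrightarrow> i \<in> {r..t} \<Longrightarrow> i < length w \<and> w ! i = k"
  by (simp add: run_def constant_interval_def)

lemma run_startD:
  assumes "run w k r t" "0 < r"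
  shows "w ! (r - 1) \<noteq> k"
proof
  assume k: "w ! (r - 1) = k"
  from assms have ci: "constant_interval w k r t" by (simp add: run_def)
  have "constant_interval w k (r - 1) t"
    unfolding constant_interval_def
  proof (intro conjI ballI)
    fix i assume "i \<in> {r - 1..t}"
    then show "w ! i = k" using ci k assms(2)
      by (cases "i = r - 1") (auto simp: constant_interval_def)
  qed (use ci assms(2) in \<open>auto simp: constant_interval_def\<close>)
  moreover have "{r..t} \<subseteq> {r - 1..t}" by auto
  ultimately have "{r - 1..t} = {r..t}" using assms(1) unfolding run_def by blast
  then show False using assms(2) ci by (auto simp: constant_interval_def)
qed

text \<open>The initial \<open>p = 0\<close> is a sentinel: it differs from every letter of
  \<open>w\<close>, so the first position always begins a run.\<close>

lemma normal_embedding_iff: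
  assumes "0 \<notin> set w"
  shows "normal_embedding \<eta> u w \<longleftrightarrow> \<eta> \<in> normal_words 0 w \<and> filter (\<lambda>x. x \<noteq> 0) \<eta> = u"
    (is "?l \<longleftrightarrow> ?r")
proof
  assume n: ?l
  then have len: "length \<eta> = length w"
    by (simp add: normal_embedding_def embedding_def)
  have runs: "\<forall>k r t. k \<ge> 1 \<and> run w k r t \<longrightarrow>
      (k = 1 \<longrightarrow> {r<..t} \<subseteq> Supp \<eta>) \<and> (k \<ge> 2 \<longrightarrow> r \<in> Supp \<eta>)"
    using n by (simp add: normal_embedding_def)
  have run1: "{r<..t} \<subseteq> Supp \<eta>" if "run w 1 r t" for r t
    using runs[rule_format, of 1 r t] that by simp
  have run2: "r \<in> Supp \<eta>" if "run w k r t" "2 \<le> k" for k r t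
    using runs[rule_format, of k r t] that by simp
  have "\<eta> ! i \<in> allowed ((0 # w) ! i) (w ! i)" if i: "i < length w" for i
    unfolding allowed_def
  proof (intro CollectI conjI impI)
    show "\<eta> ! i \<in> {w ! i, w ! i - 1, 0}"
      using n i by (simp add: normal_embedding_def)
  next
    \<comment> \<open>The sentinel rules out \<open>i = 0\<close>, so \<open>i\<close> and its
      predecessor lie in a common run of 1's, which \<open>i\<close> does not begin.\<close>
    assume 1: "w ! i = 1 \<and> (0 # w) ! i = 1"
    then obtain j where j: "i = Suc j" by (cases i) auto
    have "constant_interval w 1 j i"
      using 1 i j by (auto simp: constant_interval_def le_Suc_eq)
    from run_exists[OF this] obtain r t where "run w 1 r t" "r \<le> j" "i \<le> t"
      by blast
    with run1[of r t] j have "i \<in> Supp \<eta>" by auto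
    then show "\<eta> ! i \<noteq> 0" by (simp add: Supp_def)
  next
    assume 2: "2 \<le> w ! i \<and> (0 # w) ! i \<noteq> w ! i"
    have "constant_interval w (w ! i) i i"
      using i by (auto simp: constant_interval_def)
    from run_exists[OF this] obtain r t where rt: "run w (w ! i) r t" "r \<le> i" "i \<le> t"
      by blast
    \<comment> \<open>If the run began earlier, the letter before position \<open>i\<close> would
      equal \<open>w ! i\<close>.\<close>
    have "r = i"
    proof (rule ccontr)
      assume "r \<noteq> i"
      with rt have "i - 1 \<in> {r..t}" "0 < i" by auto
      with run_nthD[OF rt(1)] have "w ! (i - 1) = w ! i" by blast
      with 2 \<open>0 < i\<close> show False by (cases i) auto
    qed
    with run2 rt 2 show "\<eta> ! i \<noteq> 0" by (auto simp: Supp_def)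
  qed
  with n len show ?r
    by (simp add: normal_words_iff normal_embedding_def embedding_def expansion_def
        filter_eq_nths Supp_def)
next
  assume r: ?r
  then have len: "length \<eta> = length w" and
    al: "\<And>i. i < length w \<Longrightarrow> \<eta> ! i \<in> allowed ((0 # w) ! i) (w ! i)"
    by (simp_all add: normal_words_iff)
  have letter: "\<eta> ! i \<in> {w ! i, w ! i - 1, 0}" if "i < length w" for i
    using al[OF that] by (auto simp: allowed_def)
  then have "embedding \<eta> u w"
    using r len by (force simp: embedding_def expansion_def filter_eq_nths Supp_def)
  moreover have "{r<..t} \<subseteq> Supp \<eta>" if "run w 1 r t" for r t
  proof
    fix i assume i: "i \<in> {r<..t}"
    then have "i \<in> {r..t}" "i - 1 \<in> {r..t}" by auto
    then have "i < length w" "w ! i = 1" "w ! (i - 1) = 1"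
      using run_nthD[OF that] by blast+
    with al[of i] i len show "i \<in> Supp \<eta>"
      by (cases i) (auto simp: allowed_def Supp_def)
  qed
  moreover have "r \<in> Supp \<eta>" if "run w k r t" "2 \<le> k" for k r t
  proof -
    from that have "r < length w" "w ! r = k"
      by (simp_all add: run_def constant_interval_def)
    \<comment> \<open>For \<open>r = 0\<close> the preceding letter is the sentinel, otherwise
      \<open>run_startD\<close> applies; either way it differs from \<open>k\<close>.\<close>
    with al[of r] run_startD[OF that(1)] that(2) len show ?thesis
      by (cases r) (auto simp: allowed_def Supp_def)
  qed
  ultimately show ?l
    using letter unfolding normal_embedding_def by blast
qed

section \<open>The dual recursion for the sums over normal embeddings\<close>

lemma sum_normal_embeddings:
  fixes z y :: composition
  shows "(\<Sum>v\<in>{z..y}. \<Sum>\<eta> | normal_embedding \<eta> (letters v) (letters y).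
      (-1) ^ defect (letters y) \<eta>) = (of_bool (z = y) :: int)"
proof -
  define nz :: "nat list \<Rightarrow> nat list" where "nz = filter (\<lambda>x. x \<noteq> 0)"
  define S where "S = {\<eta> \<in> normal_words 0 (letters y). list_emb (\<le>) (letters z) (nz \<eta>)}"
  have pos: "0 \<notin> set (letters x)" for x
    using letters_pos by blast
  have nz: "letters (Composition (nz \<eta>)) = nz \<eta>" for \<eta>
    by (intro Composition_inverse) (auto simp: nz_def)
  \<comment> \<open>Entries of \<open>\<eta>\<close> are bounded by those of \<open>y\<close>, so
    deleting zeros gives a word below \<open>y\<close>; membership in \<open>S\<close> puts it above
    \<open>z\<close>.\<close>
  have sub: "(\<lambda>\<eta>. Composition (nz \<eta>)) ` S \<subseteq> {z..y}"
  proof clarsimp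
    fix \<eta> assume "\<eta> \<in> S"
    then have \<eta>: "\<eta> \<in> normal_words 0 (letters y)" "list_emb (\<le>) (letters z) (nz \<eta>)"
      by (auto simp: S_def)
    then have "list_all2 (\<le>) \<eta> (letters y)"
      by (force simp: normal_words_iff list_all2_conv_all_nth allowed_def)
    then have "list_emb (\<le>) (nz \<eta>) (letters y)"
      unfolding nz_def by (rule list_emb_filter_left)
    with \<eta>(2) show "z \<le> Composition (nz \<eta>) \<and> Composition (nz \<eta>) \<le> y"
      by (simp add: less_eq_composition_def subword_le_iff_list_emb nz)
  qed
  have "{\<eta>. normal_embedding \<eta> (letters v) (letters y)} = {\<eta> \<in> S. Composition (nz \<eta>) = v}"
    if "v \<in> {z..y}" for v
  proof -
    have "nz \<eta> = letters v \<longleftrightarrow> Composition (nz \<eta>) = v" for \<eta>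
      by (metis nz letters_inverse)
    moreover have "list_emb (\<le>) (letters z) (letters v)"
      using that by (simp add: less_eq_composition_def subword_le_iff_list_emb)
    ultimately show ?thesis
      unfolding normal_embedding_iff[OF pos] S_def nz_def[symmetric] by (auto simp: nz)
  qed
  then have "(\<Sum>v\<in>{z..y}. \<Sum>\<eta> | normal_embedding \<eta> (letters v) (letters y).
      (-1) ^ defect (letters y) \<eta>) =
    (\<Sum>v\<in>{z..y}. \<Sum>\<eta> \<in> {\<eta> \<in> S. Composition (nz \<eta>) = v}. (-1) ^ defect (letters y) \<eta> :: int)"
    by (intro sum.cong) auto
  also have "\<dots> = (\<Sum>\<eta>\<in>S. (-1) ^ defect (letters y) \<eta>)"
    \<comment> \<open>The fibres of \<open>Composition (nz \<eta>)\<close> over the interval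
      partition \<open>S\<close>.\<close>
    using sub by (intro sum.group finite_interval) (auto simp: S_def finite_normal_words)
  also have "\<dots> = signed_count 0 (letters z) (letters y)"
    unfolding signed_count_def S_def nz_def
    by (intro sum.mono_neutral_cong_left) (auto simp: finite_normal_words)
  also have "\<dots> = of_bool (\<exists>j. letters y = replicate j 0 @ letters z)"
    by (intro signed_count_eq pos)
  also have "(\<exists>j. letters y = replicate j 0 @ letters z) \<longleftrightarrow> z = y"
  proof
    assume "\<exists>j. letters y = replicate j 0 @ letters z"
    then obtain j where j: "letters y = replicate j 0 @ letters z" ..
    \<comment> \<open>A positive \<open>j\<close> would make 0 a letter of \<open>y\<close>.\<close>
    with pos[of y] have "j = 0" by (cases j) auto
    with j show "z = y" by (simp add: letters_inject)
  qed (auto intro: exI[of _ 0])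
  finally show ?thesis .
qed

theorem theorem1p2:
  fixes u w :: composition
  assumes "u \<le> w"
  shows "mobius u w =
    (\<Sum>\<eta> | normal_embedding \<eta> (letters u) (letters w). (-1) ^ defect (letters w) \<eta>)"
  by (rule mobius_eqI[OF assms]) (rule sum_normal_embeddings)

end
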